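(* Let $\mathcal{S},\mathcal{A}$ be finite sets of states and actions. (1) Let $f^{\tau}$ be a reward object parameterised by a transition function $\tau$, and let $\tau_1,\tau_2$ be transition functions. If $f^{\tau_1}=f^{\tau_1}\circ t$ for all $t\in S'\mathrm{R}_{\tau_1}$ and $f^{\tau_2}=f^{\tau_2}\circ t$ for all $t\in S'\mathrm{R}_{\tau_2}$, then $f^{\tau_1}$ is not $\mathrm{OPT}^{\mathcal{M}}$-robust to misspecification with $f^{\tau_2}$ for any environment $\mathcal{M}=\langle\mathcal{S},\mathcal{A},\tau,\mu_0,\_,\gamma\rangle$. (2) Let $f^{\gamma}$ be a reward object parameterised by a discount $\gamma$, and let $\gamma_1,\gamma_2$ be discounts. If $f^{\gamma_1}=f^{\gamma_1}\circ t$ for all $t\in\mathrm{PS}_{\gamma_1}$ and $f^{\gamma_2}=f^{\gamma_2}\circ t$ for all $t\in\mathrm{PS}_{\gamma_2}$, then $f^{\gamma_1}$ is not $\mathrm{OPT}^{\mathcal{M}}$-robust to misspecification with $f^{\gamma_2}$ for any environment $\mathcal{M}=\langle\mathcal{S},\mathcal{A},\tau,\mu_0,\_,\gamma\rangle$ whose transition function $\tau$ is non-trivial.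
   Context: A transition function $\tau$ maps each $(s,a)\in\mathcal{S}\times\mathcal{A}$ to a probability distribution on $\mathcal{S}$; $\mu_0$ is a probability distribution on $\mathcal{S}$; discounts lie in $(0,1]$. In every environment $\mathcal{M}$ all states are assumed reachable under $\tau$ and $\mu_0$. $\tau$ is trivial if for each $s\in\mathcal{S}$, $\tau(s,a)=\tau(s,a')$ for all $a,a'\in\mathcal{A}$. $\mathcal{R}$ is the set of all functions $R:\mathcal{S}\times\mathcal{A}\times\mathcal{S}\to\mathbb{R}$. A policy maps each state to a probability distribution on $\mathcal{A}$. Value functions are expected discounted sums $\sum_t\gamma^tR(s_t,a_t,s_{t+1})$, taken to be well-defined real numbers; $Q^\star$ is the optimal $Q$-function. A policy is optimal if and only if, in every state $s$, it only gives support to actions in $\mathrm{argmax}_{a\in\mathcal{A}}Q^\star(s,a)$. A reward object is a function $f:\mathcal{R}\to X$ for some set $X$. Given an equivalence relation (partition) $P$ on $\mathcal{R}$: $f$ is $P$-admissible if $f(R_1)=f(R_2)\Rightarrow R_1\equiv_P R_2$; $f$ is $P$-robust to misspecification with $g$ if $f$ is $P$-admissible, $f\neq g$, $\mathrm{Im}(g)\subseteq\mathrm{Im}(f)$, and $f(R_1)=g(R_2)\Rightarrow R_1\equiv_P R_2$ for all $R_1,R_2\in\mathcal{R}$. $R_1\equiv_{\mathrm{OPT}^{\mathcal{M}}}R_2$ means that $\langle \mathcal{S},\mathcal{A},\tau,\mu_0,R_1,\gamma\rangle$ and $\langle \mathcal{S},\mathcal{A},\tau,\mu_0,R_2,\gamma\rangle$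 have the same set of optimal policies. A reward transformation is a function $t:\mathcal{R}\to\mathcal{R}$. $\mathrm{PS}_{\gamma}$ is the set of all $t$ such that for each $R$ there is $\Phi:\mathcal{S}\to\mathbb{R}$ (possibly depending on $R$) with $t(R)(s,a,s')=R(s,a,s')+\gamma\Phi(s')-\Phi(s)$. $S'\mathrm{R}_\tau$ is the set of all $t$ such that for each $R$ and all $s,a$, $\mathbb{E}_{S'\sim\tau(s,a)}[t(R)(s,a,S')]=\mathbb{E}_{S'\sim\tau(s,a)}[R(s,a,S')]$.
   Formalization: Part (1) additionally assumes at least two actions; with a single action all rewards have the same optimal policies and the claim fails (e.g. two states, f^τ(R) the expected reward at a state where τ1 and τ2 differ). *)

theory Defs
  imports "HOL-Probability.Probability"
begin

type_synonym ('s, 'a) reward = "'s \<Rightarrow> 'a \<Rightarrow> 's \<Rightarrow> real"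
type_synonym ('s, 'a) transition = "'s \<Rightarrow> 'a \<Rightarrow> 's pmf"
type_synonym ('s, 'a) policy = "'s \<Rightarrow> 'a pmf"

text \<open>The finite sets of states and actions are the universes of two types of class
  \<^class>\<open>finite\<close>. An environment is an MDP without its reward.\<close>

record ('s, 'a) env =
  transition_fun :: "('s, 'a) transition"
  initial_dist :: "'s pmf"
  discount :: real

inductive reachable :: "('s, 'a) env \<Rightarrow> 's \<Rightarrow> bool" for M where
  start: "s \<in> set_pmf (initial_dist M) \<Longrightarrow> reachable M s"
| step: "reachable M s \<Longrightarrow> s' \<in> set_pmf (transition_fun M s a) \<Longrightarrow> reachable M s'"

definition trivial_transition :: "('s, 'a) transition \<Rightarrow> bool" where
  "trivial_transition \<tau> \<longleftrightarrow> (\<forall>s a a'. \<tau> s a = \<tau> s a')"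

subsection \<open>Value functions and optimal policies\<close>

text \<open>The joint law of the first \<open>n\<close> transitions \<open>(s\<^sub>t, a\<^sub>t, s\<^sub>t\<^sub>+\<^sub>1)\<close> of a trajectory from \<open>s\<close>.\<close>

primrec trajectory ::
  "('s, 'a) env \<Rightarrow> ('s, 'a) policy \<Rightarrow> nat \<Rightarrow> 's \<Rightarrow> ('s \<times> 'a \<times> 's) list pmf" where
  "trajectory M \<pi> 0 s = return_pmf []"
| "trajectory M \<pi> (Suc n) s =
     bind_pmf (\<pi> s) (\<lambda>a. bind_pmf (transition_fun M s a) (\<lambda>s'.
       map_pmf ((#) (s, a, s')) (trajectory M \<pi> n s')))"

definition discounted_return :: "real \<Rightarrow> ('s, 'a) reward \<Rightarrow> ('s \<times> 'a \<times> 's) list \<Rightarrow> real" where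
  "discounted_return \<gamma> R h = (\<Sum>t<length h. \<gamma> ^ t * (case h ! t of (s, a, s') \<Rightarrow> R s a s'))"

definition expected_return ::
  "('s, 'a) env \<Rightarrow> ('s, 'a) reward \<Rightarrow> ('s, 'a) policy \<Rightarrow> 's \<Rightarrow> nat \<Rightarrow> real" where
  "expected_return M R \<pi> s n =
     measure_pmf.expectation (trajectory M \<pi> n s) (discounted_return (discount M) R)"

text \<open>The infinite expected discounted sum is the limit of its finite-horizon truncations.
  The value \<^const>\<open>lim\<close> is meaningful only when the truncations converge; this is part of
  \<open>environment\<close> below.\<close>

definition V_fun :: "('s, 'a) env \<Rightarrow> ('s, 'a) reward \<Rightarrow> ('s, 'a) policy \<Rightarrow> 's \<Rightarrow> real" where
  "V_fun M R \<pi> s = lim (expected_return M R \<pi> s)"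

definition Q_fun :: "('s, 'a) env \<Rightarrow> ('s, 'a) reward \<Rightarrow> ('s, 'a) policy \<Rightarrow> 's \<Rightarrow> 'a \<Rightarrow> real" where
  "Q_fun M R \<pi> s a =
     measure_pmf.expectation (transition_fun M s a) (\<lambda>s'. R s a s' + discount M * V_fun M R \<pi> s')"

definition Q_star :: "('s, 'a) env \<Rightarrow> ('s, 'a) reward \<Rightarrow> 's \<Rightarrow> 'a \<Rightarrow> real" where
  "Q_star M R s a = (SUP \<pi>. Q_fun M R \<pi> s a)"

definition optimal_policies :: "('s, 'a) env \<Rightarrow> ('s, 'a) reward \<Rightarrow> ('s, 'a) policy set" where
  "optimal_policies M R =
     {\<pi>. \<forall>s. set_pmf (\<pi> s) \<subseteq> {a. is_arg_max (Q_star M R s) (\<lambda>_. True) a}}"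

text \<open>Rewards vary over all functions, so values have to be well-defined for every reward.
  For \<open>discount M < 1\<close> this always holds; for \<open>discount M = 1\<close> it never does, since the constant
  reward \<open>1\<close> has a divergent sum.\<close>

definition environment :: "('s, 'a) env \<Rightarrow> bool" where
  "environment M \<longleftrightarrow>
     0 < discount M \<and> discount M \<le> 1 \<and> (\<forall>s. reachable M s) \<and>
     (\<forall>R \<pi> s. convergent (expected_return M R \<pi> s))"

subsection \<open>Robustness to misspecification\<close>

definition admissible :: "('s, 'a) reward rel \<Rightarrow> (('s, 'a) reward \<Rightarrow> 'x) \<Rightarrow> bool" where
  "admissible P f \<longleftrightarrow> (\<forall>R1 R2. f R1 = f R2 \<longrightarrow> (R1, R2) \<in> P)"

definition robust_to_misspecification ::
  "('s, 'a) reward rel \<Rightarrow> (('s, 'a) reward \<Rightarrow> 'x) \<Rightarrow> (('s, 'a) reward \<Rightarrow> 'x) \<Rightarrow> bool" where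
  "robust_to_misspecification P f g \<longleftrightarrow>
     admissible P f \<and> f \<noteq> g \<and> range g \<subseteq> range f \<and>
     (\<forall>R1 R2. f R1 = g R2 \<longrightarrow> (R1, R2) \<in> P)"

definition OPT :: "('s, 'a) env \<Rightarrow> ('s, 'a) reward rel" where
  "OPT M = {(R1, R2). optimal_policies M R1 = optimal_policies M R2}"

lemma equiv_OPT: "equiv UNIV (OPT M)"
  by (rule equivI) (auto simp: refl_on_def sym_def trans_def OPT_def)

subsection \<open>Reward transformations\<close>

definition PS :: "real \<Rightarrow> (('s, 'a) reward \<Rightarrow> ('s, 'a) reward) set" where
  "PS \<gamma> = {t. \<forall>R. \<exists>\<Phi> :: 's \<Rightarrow> real. \<forall>s a s'. t R s a s' = R s a s' + \<gamma> * \<Phi> s' - \<Phi> s}"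

definition SR :: "('s, 'a) transition \<Rightarrow> (('s, 'a) reward \<Rightarrow> ('s, 'a) reward) set" where
  "SR \<tau> = {t. \<forall>R s a. measure_pmf.expectation (\<tau> s a) (\<lambda>s'. t R s a s') =
                       measure_pmf.expectation (\<tau> s a) (\<lambda>s'. R s a s')}"

end

theory Submission
  imports Defs
begin

text \<open>If \<open>f\<close> is robust to misspecification with \<open>g\<close>, then \<open>g\<close> is admissible as well, since every
  value of \<open>g\<close> is a value of \<open>f\<close>. Hence it suffices that a reward object which is both
  \<open>OPT\<close>-admissible and invariant under \<open>SR \<tau>'\<close> (or \<open>PS \<gamma>'\<close>) determines \<open>\<tau>'\<close> (or \<open>\<gamma>'\<close>) to be that of the
  environment: both parameters then agree, contradicting \<open>f \<noteq> g\<close>. Otherwise a transformation for the wrong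
  parameter turns the zero reward, for which all policies are optimal, into a reward whose
  optimal \<open>Q\<close>-function, exhibited as an explicit solution of the Bellman optimality equation, is
  not constant in the action.\<close>

section \<open>Expectations as finite sums, and the finite-horizon recursion for returns\<close>

lemma expectation_finite:
  fixes p :: "'b::finite pmf" and F :: "'b \<Rightarrow> real"
  shows "measure_pmf.expectation p F = (\<Sum>x\<in>UNIV. pmf p x * F x)"
  by (subst integral_measure_pmf[of UNIV]) auto


lemma expectation_mono_finite:
  fixes p :: "'b::finite pmf" and F G :: "'b \<Rightarrow> real"
  assumes "\<And>x. F x \<le> G x"
  shows "measure_pmf.expectation p F \<le> measure_pmf.expectation p G"
  unfolding expectation_finite by (intro sum_mono mult_left_mono assms) auto

lemma expectation_add_finite:
  fixes p :: "'b::finite pmf" and F G :: "'b \<Rightarrow> real"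
  shows "measure_pmf.expectation p (\<lambda>x. F x + G x) =
    measure_pmf.expectation p F + measure_pmf.expectation p G"
  unfolding expectation_finite by (simp add: algebra_simps sum.distrib)

lemma expectation_indicator_finite:
  fixes p :: "'b::finite pmf"
  shows "measure_pmf.expectation p (\<lambda>x. if x = y then 1 else 0) = pmf p y"
  unfolding expectation_finite by (simp add: if_distrib cong: if_cong)

lemma finite_set_pmf_trajectory:
  fixes M :: "('s::finite, 'a::finite) env"
  shows "finite (set_pmf (trajectory M \<pi> n s))"
  by (induction n arbitrary: s) auto

lemma expectation_bind_finite:
  fixes p :: "'b::finite pmf" and F :: "'c \<Rightarrow> real"
  assumes "\<And>x. finite (set_pmf (q x))"
  shows "measure_pmf.expectation (bind_pmf p q) F =
    measure_pmf.expectation p (\<lambda>x. measure_pmf.expectation (q x) F)"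
  by (subst pmf_expectation_bind[of UNIV]) (auto simp: assms expectation_finite)

lemma discounted_return_Cons:
  "discounted_return \<gamma> R ((s, a, s') # xs) = R s a s' + \<gamma> * discounted_return \<gamma> R xs"
  unfolding discounted_return_def
  by (simp add: sum.lessThan_Suc_shift sum_distrib_left mult.assoc del: sum.lessThan_Suc)

lemma expected_return_Suc:
  fixes M :: "('s::finite, 'a::finite) env"
  shows "expected_return M R \<pi> s (Suc n) =
    measure_pmf.expectation (\<pi> s) (\<lambda>a. measure_pmf.expectation (transition_fun M s a)
      (\<lambda>s'. R s a s' + discount M * expected_return M R \<pi> s' n))"
proof -
  have "measure_pmf.expectation (trajectory M \<pi> n s')
      (\<lambda>xs. R s a s' + discount M * discounted_return (discount M) R xs)
    = R s a s' + discount M * expected_return M R \<pi> s' n" for a s'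
    unfolding expected_return_def
    by (subst Bochner_Integration.integral_add)
      (auto intro!: integrable_measure_pmf_finite finite_set_pmf_trajectory)
  then show ?thesis
    unfolding expected_return_def
    by (simp add: expectation_bind_finite finite_set_pmf_trajectory discounted_return_Cons)
qed

text \<open>Without discounting, the constant reward 1 has \<open>n\<close>-step return
  \<open>n\<close>, which diverges as the horizon grows.\<close>

lemma environment_discount_less_1:
  fixes M :: "('s::finite, 'a::finite) env"
  assumes "environment M"
  shows "discount M < 1"
proof (rule ccontr)
  assume "\<not> discount M < 1"
  then have "discount M = 1"
    using assms by (simp add: environment_def)
  then have "expected_return M (\<lambda>_ _ _. 1) \<pi> s n = real n" for \<pi> s n
    by (induction n arbitrary: s)
      (simp_all add: expected_return_Suc, simp add: expected_return_def discounted_return_def)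
  then have one: "expected_return M (\<lambda>_ _ _. 1) \<pi> s = real" for \<pi> s
    by blast
  have "convergent (expected_return M (\<lambda>_ _ _. 1) undefined undefined)"
    using assms unfolding environment_def by blast
  then have "\<exists>L. real \<longlonglongrightarrow> L"
    unfolding one convergent_def .
  then show False
    using filterlim_real_sequentially not_tendsto_and_filterlim_at_infinity
      filterlim_at_top_imp_at_infinity trivial_limit_sequentially by blast
qed

text \<open>The finite-horizon recursion passes to the limit: its expectations are finite sums, and
  in an environment all truncations converge.\<close>

lemma V_fun_Bellman:
  fixes M :: "('s::finite, 'a::finite) env"
  assumes "environment M"
  shows "V_fun M R \<pi> s = measure_pmf.expectation (\<pi> s) (Q_fun M R \<pi> s)"
proof -
  have lim: "expected_return M R \<pi> x \<longlonglongrightarrow> V_fun M R \<pi> x" for x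
    using assms by (simp add: environment_def V_fun_def convergent_LIMSEQ_iff)
  have "(\<lambda>n. expected_return M R \<pi> s (Suc n)) \<longlonglongrightarrow> measure_pmf.expectation (\<pi> s) (Q_fun M R \<pi> s)"
    unfolding expected_return_Suc Q_fun_def expectation_finite
    by (intro tendsto_intros lim)
  then show ?thesis
    using LIMSEQ_unique LIMSEQ_Suc[OF lim] by blast
qed

section \<open>The Bellman optimality equation\<close>

lemma contraction_le_0:
  fixes D :: "'s::finite \<Rightarrow> real"
  assumes "0 \<le> \<gamma>" "\<gamma> < 1" and D: "\<And>x. D x \<le> \<gamma> * Max (range D)"
  shows "D x \<le> 0"
proof -
  have "Max (range D) \<in> range D"
    by (rule Max_in) auto
  then obtain y where "Max (range D) = D y" by (rule rangeE)
  \<comment> \<open>At a maximiser \<open>y\<close> the hypothesis reads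
    \<open>D y \<le> \<gamma> * D y\<close>; since \<gamma> is below 1, the maximum cannot be
    positive.\<close>
  with D[of y] have "(1 - \<gamma>) * Max (range D) \<le> 0"
    by (simp add: algebra_simps)
  with \<open>\<gamma> < 1\<close> have "Max (range D) \<le> 0"
    by (simp add: mult_le_0_iff)
  moreover have "D x \<le> Max (range D)" by simp
  ultimately show ?thesis by linarith
qed

text \<open>A verification argument. The gap between a policy's value and \<open>w\<close> contracts
  by the discount: for an arbitrary policy this shows that its value is at most \<open>w\<close>,
  and for a policy greedy in \<open>Q\<close> that \<open>w\<close> is at most its value.\<close>

lemma Q_star_eqI:
  fixes M :: "('s::finite, 'a::finite) env"
  assumes env: "environment M"
    and Q: "\<And>s a. measure_pmf.expectation (transition_fun M s a)
      (\<lambda>s'. R s a s' + discount M * Max (range (Q s'))) = Q s a"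
  shows "Q_star M R = Q"
proof (intro ext)
  fix s a
  define w where "w x = Max (range (Q x))" for x
  have disc: "0 \<le> discount M" "discount M < 1"
    using env environment_discount_less_1[OF env] by (simp_all add: environment_def)
  have diff: "Q_fun M R \<pi> x b - Q x b =
      measure_pmf.expectation (transition_fun M x b) (\<lambda>y. discount M * (V_fun M R \<pi> y - w y))"
    for \<pi> x b
    unfolding Q[of x b, symmetric] Q_fun_def w_def expectation_finite
    by (simp add: sum_subtractf[symmetric] algebra_simps)
  have le: "Q_fun M R \<pi> x b \<le> Q x b" for \<pi> x b
  proof -
    define D where "D x = V_fun M R \<pi> x - w x" for x
    have step: "Q_fun M R \<pi> x b - Q x b \<le> discount M * Max (range D)" for x b
    proof -
      have "measure_pmf.expectation (transition_fun M x b) (\<lambda>y. discount M * D y)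
          \<le> measure_pmf.expectation (transition_fun M x b) (\<lambda>_. discount M * Max (range D))"
        using disc by (intro expectation_mono_finite mult_left_mono) auto
      then show ?thesis
        unfolding diff D_def by simp
    qed
    have "D x \<le> discount M * Max (range D)" for x
    proof -
      have "Q_fun M R \<pi> x b \<le> w x + discount M * Max (range D)" for b
      proof -
        have "Q x b \<le> w x"
          unfolding w_def by (rule Max_ge) auto
        with step[of x b] show ?thesis by linarith
      qed
      \<comment> \<open>Averaging the bound over the actions of \<pi> turns its left side into
        \<open>V_fun M R \<pi> x\<close>.\<close>
      from expectation_mono_finite[of "Q_fun M R \<pi> x", OF this, of "\<pi> x"]
      show ?thesis
        unfolding D_def V_fun_Bellman[OF env, of R \<pi> x] by simp
    qed
    then have "D y \<le> 0" for y
      by (rule contraction_le_0[OF disc])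
    then have "measure_pmf.expectation (transition_fun M x b) (\<lambda>y. discount M * D y)
        \<le> measure_pmf.expectation (transition_fun M x b) (\<lambda>_. 0)"
      using disc by (intro expectation_mono_finite) (simp add: mult_le_0_iff)
    then show ?thesis
      using diff[of \<pi> x b] by (simp add: D_def)
  qed
  have "\<exists>b. Q x b = w x" for x
    using Max_in[of "range (Q x)"] unfolding w_def by fastforce
  then obtain g where g: "\<And>x. Q x (g x) = w x" by metis
  \<comment> \<open>The greedy policy, which will attain the supremum in
    \<open>Q_star\<close>.\<close>
  define \<pi> where "\<pi> x = return_pmf (g x)" for x
  have V: "V_fun M R \<pi> x = Q_fun M R \<pi> x (g x)" for x
    unfolding V_fun_Bellman[OF env, of R \<pi> x] \<pi>_def by simp
  define D where "D x = w x - V_fun M R \<pi> x" for x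
  have "D x \<le> discount M * Max (range D)" for x
  proof -
    \<comment> \<open>Since \<open>g x\<close> attains \<open>w x\<close>, the value gap at
      \<open>x\<close> is the gap between \<open>Q\<close> and \<open>Q_fun\<close> at the greedy
      action, hence a discounted average of gaps at successors.\<close>
    have "D x = measure_pmf.expectation (transition_fun M x (g x)) (\<lambda>y. discount M * D y)"
      using diff[of \<pi> x "g x"] unfolding D_def V g expectation_finite
      by (simp add: sum_negf[symmetric] sum_subtractf algebra_simps)
    also have "\<dots> \<le> measure_pmf.expectation (transition_fun M x (g x))
        (\<lambda>_. discount M * Max (range D))"
      using disc by (intro expectation_mono_finite mult_left_mono) auto
    finally show ?thesis by simp
  qed
  then have "D x \<le> 0" for x
    by (rule contraction_le_0[OF disc])
  then have "measure_pmf.expectation (transition_fun M s a) (\<lambda>_. 0)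
      \<le> measure_pmf.expectation (transition_fun M s a) (\<lambda>y. discount M * (V_fun M R \<pi> y - w y))"
    using disc by (intro expectation_mono_finite) (simp add: D_def)
  then have "Q s a \<le> Q_fun M R \<pi> s a"
    using diff[of \<pi> s a] by simp
  with le[of \<pi> s a] have "Q s a = Q_fun M R \<pi> s a" by simp
  \<comment> \<open>The upper bound \<open>Q s a\<close> is itself attained, so it is a maximum and
    therefore the supremum.\<close>
  then have "Q s a \<in> range (\<lambda>\<pi>. Q_fun M R \<pi> s a)" by (rule range_eqI[where x = \<pi>])
  then show "Q_star M R s a = Q s a"
    unfolding Q_star_def by (rule cSup_eq_maximum) (elim rangeE, simp only: le)
qed

section \<open>Rewards for which every policy is optimal\<close>

lemma optimal_policies_zero:
  fixes M :: "('s::finite, 'a::finite) env"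
  assumes "environment M"
  shows "optimal_policies M (\<lambda>_ _ _. 0) = UNIV"
proof -
  have "Q_star M (\<lambda>_ _ _. 0) = (\<lambda>_ _. 0)"
    by (rule Q_star_eqI[OF assms]) simp
  then show ?thesis
    by (simp add: optimal_policies_def is_arg_max_def)
qed

lemma optimal_policies_neq_UNIV:
  assumes "Q_star M R s a \<noteq> Q_star M R s b"
  shows "optimal_policies M R \<noteq> UNIV"
proof
  assume all: "optimal_policies M R = UNIV"
  have "is_arg_max (Q_star M R s) (\<lambda>_. True) c" for c
  proof -
    \<comment> \<open>The policy that always plays \<open>c\<close> tests whether \<open>c\<close>
      is a maximiser at \<open>s\<close>.\<close>
    have "(\<lambda>_. return_pmf c) \<in> optimal_policies M R"
      using all by simp
    then show ?thesis
      by (simp add: optimal_policies_def)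
  qed
  from this[of a] this[of b] assms show False
    by (auto simp: is_arg_max_linorder intro: antisym)
qed

lemma not_OPT_zero:
  fixes M :: "('s::finite, 'a::finite) env"
  assumes "environment M" "Q_star M R s a \<noteq> Q_star M R s b"
  shows "(R, \<lambda>_ _ _. 0) \<notin> OPT M"
  using optimal_policies_zero[OF assms(1)] optimal_policies_neq_UNIV[OF assms(2)]
  by (simp add: OPT_def)

section \<open>Consequences of robustness and of invariance\<close>

lemma robust_imp_admissible_right:
  assumes "equiv UNIV P" "robust_to_misspecification P f g"
  shows "admissible P g"
  unfolding admissible_def
proof (intro allI impI)
  fix R1 R2
  assume eq: "g R1 = g R2"
  \<comment> \<open>An \<open>f\<close>-preimage of the common value is equivalent to both
    \<open>R1\<close> and \<open>R2\<close> and so links them.\<close>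
  obtain R3 where "f R3 = g R1"
    using assms(2) unfolding robust_to_misspecification_def by (metis rangeI rangeE subsetD)
  with eq assms(2) have "(R3, R1) \<in> P" "(R3, R2) \<in> P"
    by (auto simp: robust_to_misspecification_def)
  with assms(1) show "(R1, R2) \<in> P"
    by (metis equivE symD transD)
qed

text \<open>A transformation may treat each reward separately, so the one moving only
  \<open>R\<close> is available.\<close>

lemma SR_invariant_eq:
  assumes "\<forall>t\<in>SR \<tau>. f = f \<circ> t"
    and "\<And>s a. measure_pmf.expectation (\<tau> s a) (R' s a) = measure_pmf.expectation (\<tau> s a) (R s a)"
  shows "f R' = f R"
proof -
  have "id(R := R') \<in> SR \<tau>"
    using assms(2) by (auto simp: SR_def)
  with assms(1) have "f = f \<circ> id(R := R')" by blast
  from fun_cong[OF this, of R] show ?thesis by simp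
qed

lemma PS_invariant_eq:
  assumes "\<forall>t\<in>PS \<gamma>. f = f \<circ> t"
  shows "f (\<lambda>s a s'. R s a s' + \<gamma> * \<Phi> s' - \<Phi> s) = f R"
proof -
  let ?t = "\<lambda>R s a s'. R s a s' + \<gamma> * \<Phi> s' - \<Phi> s"
  have "?t \<in> PS \<gamma>"
    by (auto simp: PS_def)
  with assms have "f = f \<circ> ?t" by blast
  from fun_cong[OF this, of R] show ?thesis by simp
qed

text \<open>A reward with mean zero under \<tau> everywhere can have nonzero mean under the true
  transitions at a pair where the two differ. The second action serves as the comparison that makes
  this visible to optimal policies.\<close>

lemma admissible_SR_invariant_imp_eq:
  fixes M :: "('s::finite, 'a::finite) env"
  assumes env: "environment M" and card: "CARD('a) \<ge> 2"
    and adm: "admissible (OPT M) f" and inv: "\<forall>t\<in>SR \<tau>. f = f \<circ> t"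
  shows "\<tau> = transition_fun M"
proof (rule ccontr)
  let ?T = "transition_fun M"
  assume "\<tau> \<noteq> ?T"
  then obtain s a where "\<tau> s a \<noteq> ?T s a" by (auto simp: fun_eq_iff)
  then obtain y where y: "pmf (\<tau> s a) y \<noteq> pmf (?T s a) y"
    by (auto simp: pmf_eq_iff)
  define d where "d = pmf (\<tau> s a) y - pmf (?T s a) y"
  have d: "d \<noteq> 0" using y by (simp add: d_def)
  \<comment> \<open>The indicator of \<open>y\<close>, centred under \<open>\<tau> s a\<close>;
    dividing by \<open>d\<close> makes its mean under the true transitions exactly -1.\<close>
  define R where "R = (\<lambda>x b x'. if x = s \<and> b = a
    then ((if x' = y then 1 else 0) + - pmf (\<tau> s a) y) / d else 0)"
  have R: "measure_pmf.expectation p (R x b) =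
      (if x = s \<and> b = a then (pmf p y - pmf (\<tau> s a) y) / d else 0)" for p x b
    unfolding R_def
    by (cases "x = s"; cases "b = a")
      (simp_all add: expectation_add_finite expectation_indicator_finite del: add_uminus_conv_diff)
  have "f R = f (\<lambda>_ _ _. 0)"
    by (rule SR_invariant_eq[OF inv]) (simp add: R)
  with adm have eq: "(R, \<lambda>_ _ _. 0) \<in> OPT M"
    unfolding admissible_def by blast
  define Q :: "'s \<Rightarrow> 'a \<Rightarrow> real" where "Q = (\<lambda>x b. if x = s \<and> b = a then -1 else 0)"
  have "UNIV \<noteq> {a}"
    using card by (metis card_1_singleton_iff numeral_2_eq_2 One_nat_def not_less_eq_eq order_refl)
  then obtain b where b: "b \<noteq> a" by blast
  \<comment> \<open>The negative sign matters: at \<open>s\<close> the action \<open>b\<close> still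
    offers 0, so all optimal continuation values vanish and \<open>Q\<close> is just the mean
    immediate reward.\<close>
  have Max_Q: "Max (range (Q x)) = 0" for x
    by (rule Max_eqI) (auto simp: Q_def b intro!: image_eqI[of _ _ b])
  have "Q_star M R = Q"
  proof (rule Q_star_eqI[OF env])
    show "measure_pmf.expectation (?T x c) (\<lambda>x'. R x c x' + discount M * Max (range (Q x')))
        = Q x c" for x c
      unfolding Max_Q using d by (auto simp: R Q_def d_def divide_eq_minus_1_iff)
  qed
  then have "Q_star M R s a \<noteq> Q_star M R s b"
    using b by (simp add: Q_def)
  from not_OPT_zero[OF env this] eq show False by simp
qed

text \<open>Shaping with the wrong discount leaves a residue proportional to
  \<open>\<gamma> - discount M\<close>. A suitable potential makes the optimal values, up to a term
  depending only on the state, the probability of moving to \<open>y\<close>.\<close>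

lemma admissible_PS_invariant_imp_eq:
  fixes M :: "('s::finite, 'a::finite) env"
  assumes env: "environment M" and nontriv: "\<not> trivial_transition (transition_fun M)"
    and adm: "admissible (OPT M) f" and inv: "\<forall>t\<in>PS \<gamma>. f = f \<circ> t"
  shows "\<gamma> = discount M"
proof (rule ccontr)
  let ?T = "transition_fun M"
  assume "\<gamma> \<noteq> discount M"
  then have c: "\<gamma> - discount M \<noteq> 0" by simp
  obtain s a b where "?T s a \<noteq> ?T s b"
    using nontriv by (auto simp: trivial_transition_def)
  then obtain y where y: "pmf (?T s a) y \<noteq> pmf (?T s b) y"
    by (auto simp: pmf_eq_iff)
  define w where "w x = Max (range (\<lambda>e. pmf (?T x e) y))" for x
  txt \<open>\<open>\<Phi>\<close> is chosen so that one-step lookahead on the value \<open>w - \<Phi>\<close> returns \<open>Q\<close>: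
    \<open>\<gamma> * \<Phi> + discount M * (w - \<Phi>)\<close> is the indicator of \<open>y\<close>.\<close>
  define \<Phi> where "\<Phi> x = ((if x = y then 1 else 0) - discount M * w x) / (\<gamma> - discount M)" for x
  define R :: "('s, 'a) reward" where "R = (\<lambda>x e x'. 0 + \<gamma> * \<Phi> x' - \<Phi> x)"
  define Q where "Q x e = pmf (?T x e) y + - \<Phi> x" for x e
  have Max_Q: "Max (range (Q x)) = w x + - \<Phi> x" for x
    unfolding Q_def w_def by (rule Max_add_commute) auto
  have R: "R x e x' + discount M * Max (range (Q x')) = (if x' = y then 1 else 0) + - \<Phi> x"
    for x e x'
  proof -
    have "(\<gamma> - discount M) * \<Phi> x' = (if x' = y then 1 else 0) - discount M * w x'"
      using c by (simp add: \<Phi>_def)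
    then show ?thesis
      by (simp add: R_def Max_Q algebra_simps)
  qed
  have "Q_star M R = Q"
    by (rule Q_star_eqI[OF env], unfold R)
      (simp add: Q_def expectation_add_finite expectation_indicator_finite
        del: add_uminus_conv_diff)
  \<comment> \<open>The term \<open>- \<Phi> s\<close> is common to both actions, so the difference
    is that of the transition probabilities to \<open>y\<close>.\<close>
  then have "Q_star M R s a \<noteq> Q_star M R s b"
    using y by (simp add: Q_def)
  from not_OPT_zero[OF env this] have "(R, \<lambda>_ _ _. 0) \<notin> OPT M" .
  moreover have "f R = f (\<lambda>_ _ _. 0)"
    unfolding R_def by (rule PS_invariant_eq[OF inv])
  ultimately show False
    using adm unfolding admissible_def by blast
qed

theorem theorem3p7:
  fixes M :: "('s::finite, 'a::finite) env"
    and f :: "('s, 'a) transition \<Rightarrow> ('s, 'a) reward \<Rightarrow> 'x"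
    and \<tau>1 \<tau>2 :: "('s, 'a) transition"
    and h :: "real \<Rightarrow> ('s, 'a) reward \<Rightarrow> 'y"
    and \<gamma>1 \<gamma>2 :: real
  assumes env: "environment M"
  shows "(CARD('a) \<ge> 2 \<longrightarrow>
            (\<forall>t\<in>SR \<tau>1. f \<tau>1 = f \<tau>1 \<circ> t) \<longrightarrow>
            (\<forall>t\<in>SR \<tau>2. f \<tau>2 = f \<tau>2 \<circ> t) \<longrightarrow>
            \<not> robust_to_misspecification (OPT M) (f \<tau>1) (f \<tau>2)) \<and>
         (\<gamma>1 \<in> {0<..1} \<longrightarrow> \<gamma>2 \<in> {0<..1} \<longrightarrow>
            (\<forall>t\<in>PS \<gamma>1. h \<gamma>1 = h \<gamma>1 \<circ> t) \<longrightarrow>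
            (\<forall>t\<in>PS \<gamma>2. h \<gamma>2 = h \<gamma>2 \<circ> t) \<longrightarrow>
            \<not> trivial_transition (transition_fun M) \<longrightarrow>
            \<not> robust_to_misspecification (OPT M) (h \<gamma>1) (h \<gamma>2))"
proof (intro conjI impI notI)
  assume card: "CARD('a) \<ge> 2"
    and inv1: "\<forall>t\<in>SR \<tau>1. f \<tau>1 = f \<tau>1 \<circ> t" and inv2: "\<forall>t\<in>SR \<tau>2. f \<tau>2 = f \<tau>2 \<circ> t"
    and rob: "robust_to_misspecification (OPT M) (f \<tau>1) (f \<tau>2)"
  from rob have "admissible (OPT M) (f \<tau>1)" and neq: "f \<tau>1 \<noteq> f \<tau>2"
    by (simp_all add: robust_to_misspecification_def)
  \<comment> \<open>Both equal \<open>transition_fun M\<close>: the first by admissibility of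
    \<open>f \<tau>1\<close>, the second by the admissibility that \<open>f \<tau>2\<close>
    inherits.\<close>
  then have "\<tau>1 = \<tau>2"
    using admissible_SR_invariant_imp_eq[OF env card _ inv1]
      admissible_SR_invariant_imp_eq[OF env card
        robust_imp_admissible_right[OF equiv_OPT rob] inv2] by simp
  with neq show False by simp
next
  assume inv1: "\<forall>t\<in>PS \<gamma>1. h \<gamma>1 = h \<gamma>1 \<circ> t" and inv2: "\<forall>t\<in>PS \<gamma>2. h \<gamma>2 = h \<gamma>2 \<circ> t"
    and nontriv: "\<not> trivial_transition (transition_fun M)"
    and rob: "robust_to_misspecification (OPT M) (h \<gamma>1) (h \<gamma>2)"
  from rob have "admissible (OPT M) (h \<gamma>1)" and neq: "h \<gamma>1 \<noteq> h \<gamma>2"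
    by (simp_all add: robust_to_misspecification_def)
  then have "\<gamma>1 = \<gamma>2"
    using admissible_PS_invariant_imp_eq[OF env nontriv _ inv1]
      admissible_PS_invariant_imp_eq[OF env nontriv
        robust_imp_admissible_right[OF equiv_OPT rob] inv2] by simp
  with neq show False by simp
qed

end
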